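(* Let $\Phi$ be a finite set of topics, $d$ a document, and $\kappa_d$ an integer with $1\le\kappa_d\le|\Phi|$. There is a deterministic algorithm that, using only $d$, $\Phi$ and $\kappa_d$ (and hence independently of all other documents), computes in $\kappa_d$ iterations, each of complexity $O(\ell|\Phi|)$, a set of topics $E_d\subseteq\Phi$ with $1\le|E_d|\le\kappa_d$ that is a $1-1/e$ approximation to the document's optimal log MAP topic-word assignment value: $$\dot f^+(E_d)\ \ge\ (1-1/e)\max\{\dot f^+(T): T\subseteq\Phi,\ 1\le|T|\le\kappa_d\}.$$
   Context: A document $d=[w_{d,1},\dots,w_{d,|d|}]$ is a finite list of words from a finite vocabulary $V$; $\ell$ is an upper bound on the document length $|d|$ (the maximum length over all documents considered). A topic $\tau\in\Phi$ is a probability distribution $\phi_\tau$ on $V$; $\phi_\tau[v]$ is the probability of word $v$ (with $\log0=-\infty$). The out-of-sample log MAP objective for a single document is $$f^+(E_d)=\sum_{i=1}^{|d|}\max_{\tau\in E_d}\log\phi_\tau[w_{d,i}],$$ to be maximized over $E_d\subseteq\Phi$ with $1\le|E_d|\le\kappa_d$. Its version normalized by an improper placeholder topic that gives a fixed infinitesimal weight $\varepsilon>0$ to every word ($\varepsilon$ smaller than every nonzero topic probability) is $$\dot f^+(T)=\sum_{i=1}^{|d|}\Big(\max\big\{\log\varepsilon,\max_{\tau\in T}\log\phi_\tau[w_{d,i}]\big\}-\log\varepsilon\Big).$$ Complexity is counted in unit-cost arithmetic operations, comparisons and memory accesses. *)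

theory Defs
  imports "HOL-Probability.Probability_Mass_Function"
begin

section \<open>The normalized out-of-sample MAP objective\<close>

text \<open>
  Logarithm of a nonnegative weight, with \<open>log 0 = -\<infinity>\<close> (the library's \<^const>\<open>ln\<close> has
  \<open>ln 0 = 0\<close>).
\<close>

definition log_weight :: "real \<Rightarrow> ereal" where
  "log_weight x = (if x = 0 then -\<infinity> else ereal (ln x))"

text \<open>
  \<open>\<phi> \<tau>\<close> is the word distribution of the topic \<open>\<tau>\<close>; distinct topics may have equal
  distributions. The inner \<^const>\<open>Max\<close> is only meaningful for a finite nonempty \<open>T\<close>.
\<close>

definition fdot :: "real \<Rightarrow> ('t \<Rightarrow> 'w pmf) \<Rightarrow> 'w list \<Rightarrow> 't set \<Rightarrow> ereal" where
  "fdot \<epsilon> \<phi> d T =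
     (\<Sum>i<length d.
        max (log_weight \<epsilon>) (Max ((\<lambda>\<tau>. log_weight (pmf (\<phi> \<tau>) (d ! i))) ` T)) - log_weight \<epsilon>)"


section \<open>A unit-cost random access machine over the naturals and the reals\<close>

text \<open>
  The memory consists of arrays of naturals and arrays of reals. Array names are literals of the
  program, cell indices are computed. Arithmetic is exact; there is no conversion between the two
  sorts, no rounding, and no logarithm. Subtraction on the naturals is truncated.
\<close>

record store =
  nmem :: "nat \<Rightarrow> nat \<Rightarrow> nat"
  rmem :: "nat \<Rightarrow> nat \<Rightarrow> real"

datatype nexp =
    NLit nat
  | NRead nat nexp
  | NAdd nexp nexp
  | NSub nexp nexp
  | NMul nexp nexp

datatype rexp =
    RLit real
  | RRead nat nexp
  | RAdd rexp rexp
  | RSub rexp rexp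
  | RMul rexp rexp
  | RDiv rexp rexp

datatype bexp =
    NLess nexp nexp
  | RLess rexp rexp
  | BNot bexp
  | BAnd bexp bexp

datatype com =
    Skip
  | NWrite nat nexp nexp
  | RWrite nat nexp rexp
  | Seq com com
  | Cond bexp com com
  | While bexp com

primrec nval :: "nexp \<Rightarrow> store \<Rightarrow> nat" where
  "nval (NLit k) s = k"
| "nval (NRead a e) s = nmem s a (nval e s)"
| "nval (NAdd e f) s = nval e s + nval f s"
| "nval (NSub e f) s = nval e s - nval f s"
| "nval (NMul e f) s = nval e s * nval f s"

primrec rval :: "rexp \<Rightarrow> store \<Rightarrow> real" where
  "rval (RLit x) s = x"
| "rval (RRead a e) s = rmem s a (nval e s)"
| "rval (RAdd e f) s = rval e s + rval f s"
| "rval (RSub e f) s = rval e s - rval f s"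
| "rval (RMul e f) s = rval e s * rval f s"
| "rval (RDiv e f) s = rval e s / rval f s"

primrec bval :: "bexp \<Rightarrow> store \<Rightarrow> bool" where
  "bval (NLess e f) s = (nval e s < nval f s)"
| "bval (RLess e f) s = (rval e s < rval f s)"
| "bval (BNot b) s = (\<not> bval b s)"
| "bval (BAnd b c) s = (bval b s \<and> bval c s)"

text \<open>Every literal, memory access, arithmetic operation, comparison and connective costs 1.\<close>

primrec ncost :: "nexp \<Rightarrow> nat" where
  "ncost (NLit k) = 1"
| "ncost (NRead a e) = ncost e + 1"
| "ncost (NAdd e f) = ncost e + ncost f + 1"
| "ncost (NSub e f) = ncost e + ncost f + 1"
| "ncost (NMul e f) = ncost e + ncost f + 1"

primrec rcost :: "rexp \<Rightarrow> nat" where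
  "rcost (RLit x) = 1"
| "rcost (RRead a e) = ncost e + 1"
| "rcost (RAdd e f) = rcost e + rcost f + 1"
| "rcost (RSub e f) = rcost e + rcost f + 1"
| "rcost (RMul e f) = rcost e + rcost f + 1"
| "rcost (RDiv e f) = rcost e + rcost f + 1"

primrec bcost :: "bexp \<Rightarrow> nat" where
  "bcost (NLess e f) = ncost e + ncost f + 1"
| "bcost (RLess e f) = rcost e + rcost f + 1"
| "bcost (BNot b) = bcost b + 1"
| "bcost (BAnd b c) = bcost b + bcost c + 1"

definition nwrite :: "nat \<Rightarrow> nat \<Rightarrow> nat \<Rightarrow> store \<Rightarrow> store" where
  "nwrite a i x s = s\<lparr>nmem := (nmem s)(a := (nmem s a)(i := x))\<rparr>"

definition rwrite :: "nat \<Rightarrow> nat \<Rightarrow> real \<Rightarrow> store \<Rightarrow> store" where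
  "rwrite a i x s = s\<lparr>rmem := (rmem s)(a := (rmem s a)(i := x))\<rparr>"

text \<open>\<open>exec c s n t\<close>: started in \<open>s\<close>, the command \<open>c\<close> halts in \<open>t\<close> at total cost \<open>n\<close>.\<close>

inductive exec :: "com \<Rightarrow> store \<Rightarrow> nat \<Rightarrow> store \<Rightarrow> bool" where
  Skip: "exec Skip s 1 s"
| NWrite: "exec (NWrite a i e) s (ncost i + ncost e + 1) (nwrite a (nval i s) (nval e s) s)"
| RWrite: "exec (RWrite a i e) s (ncost i + rcost e + 1) (rwrite a (nval i s) (rval e s) s)"
| Seq: "exec c s m t \<Longrightarrow> exec c' t n u \<Longrightarrow> exec (Seq c c') s (m + n) u"
| CondTrue: "bval b s \<Longrightarrow> exec c s n t \<Longrightarrow> exec (Cond b c c') s (bcost b + n) t"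
| CondFalse: "\<not> bval b s \<Longrightarrow> exec c' s n t \<Longrightarrow> exec (Cond b c c') s (bcost b + n) t"
| WhileFalse: "\<not> bval b s \<Longrightarrow> exec (While b c) s (bcost b) s"
| WhileTrue: "bval b s \<Longrightarrow> exec c s m t \<Longrightarrow> exec (While b c) t n u \<Longrightarrow>
    exec (While b c) s (bcost b + m + n) u"

inductive_cases exec_SkipE: "exec Skip s n t"
inductive_cases exec_NWriteE: "exec (NWrite a i e) s n t"
inductive_cases exec_RWriteE: "exec (RWrite a i e) s n t"
inductive_cases exec_SeqE: "exec (Seq c c') s n t"
inductive_cases exec_CondE: "exec (Cond b c c') s n t"
inductive_cases exec_WhileE: "exec (While b c) s n t"

lemma exec_deterministic: "exec c s n t \<Longrightarrow> exec c s n' t' \<Longrightarrow> n' = n \<and> t' = t"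
proof (induction arbitrary: n' t' rule: exec.induct)
  case (Skip s)
  then show ?case by (auto elim: exec_SkipE)
next
  case (NWrite a i e s)
  then show ?case by (auto elim: exec_NWriteE)
next
  case (RWrite a i e s)
  then show ?case by (auto elim: exec_RWriteE)
next
  case (Seq c s m t c' n u)
  from Seq.prems show ?case by (rule exec_SeqE) (use Seq.IH in blast)
next
  case (CondTrue b s c n t c')
  from CondTrue.prems show ?case by (rule exec_CondE) (use CondTrue.IH CondTrue.hyps in blast)+
next
  case (CondFalse b s c' n t c)
  from CondFalse.prems show ?case by (rule exec_CondE) (use CondFalse.IH CondFalse.hyps in blast)+
next
  case (WhileFalse b s c)
  from WhileFalse.prems show ?case by (rule exec_WhileE) (use WhileFalse.hyps in blast)+
next
  case (WhileTrue b s c m t n u)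
  from WhileTrue.prems show ?case by (rule exec_WhileE) (use WhileTrue.IH WhileTrue.hyps in blast)+
qed

text \<open>
  \<open>iterations c B k s t\<close>: executing \<open>c\<close> exactly \<open>k\<close> times in succession leads from \<open>s\<close> to \<open>t\<close>, and
  each single execution halts at cost at most \<open>B\<close>.
\<close>

inductive iterations :: "com \<Rightarrow> nat \<Rightarrow> nat \<Rightarrow> store \<Rightarrow> store \<Rightarrow> bool" for c B where
  Done: "iterations c B 0 s s"
| Step: "exec c s n t \<Longrightarrow> n \<le> B \<Longrightarrow> iterations c B k t u \<Longrightarrow> iterations c B (Suc k) s u"


section \<open>Memory layout of the input and the output\<close>

text \<open>
  The machine sees a word of the vocabulary as its position in an enumeration \<open>vs\<close>, and a topic as
  its position in an enumeration \<open>ts\<close>. The initial store holds the sizes and \<open>\<kappa>\<close> (natural array 0),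
  the document (natural array 1) and the topic-word probabilities in row-major order (real
  array 0). All other cells are zero.
\<close>

definition position :: "'a list \<Rightarrow> 'a \<Rightarrow> nat" where
  "position xs x = (LEAST i. i < length xs \<and> xs ! i = x)"

definition cells :: "'a::zero list \<Rightarrow> nat \<Rightarrow> 'a" where
  "cells xs i = (if i < length xs then xs ! i else 0)"

definition input_store ::
  "'w list \<Rightarrow> 't list \<Rightarrow> ('t \<Rightarrow> 'w pmf) \<Rightarrow> 'w list \<Rightarrow> nat \<Rightarrow> store" where
  "input_store vs ts \<phi> d \<kappa> =
     \<lparr>nmem = (\<lambda>_ _. 0)
        (0 := cells [length d, length vs, length ts, \<kappa>],
         1 := cells (map (position vs) d)),
      rmem = (\<lambda>_ _. 0)
        (0 := cells (concat (map (\<lambda>\<tau>. map (pmf (\<phi> \<tau>)) vs) ts)))\<rparr>"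

text \<open>
  The result is read from natural array 2: cell 0 holds the number of entries, and the following
  cells hold that many topic positions (repetitions allowed).
\<close>

definition output_positions :: "store \<Rightarrow> nat set" where
  "output_positions s = (\<lambda>i. nmem s 2 (Suc i)) ` {..<nmem s 2 0}"

end

theory Submission
  imports Defs
begin

text \<open>
  The algorithm is the greedy one. The objective is \<open>\<Sum>\<^sub>i ln (W\<^sub>i T) - ln \<epsilon>\<close>, where \<open>W\<^sub>i T\<close> is the
  largest weight that \<open>\<epsilon>\<close> and the topics of \<open>T\<close> give to the \<open>i\<close>-th word; it is monotone and
  submodular, so a greedy step closes at least the fraction \<open>1/\<kappa>\<close> of the gap to the optimum, and
  \<open>(1 - 1/\<kappa>)^\<kappa> \<le> 1/e\<close>. The machine has no logarithm, but maximizing the objective over the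
  candidate topics is the same as maximizing the product \<open>\<Prod>\<^sub>i W\<^sub>i\<close>. Keeping the weights \<open>W\<^sub>i\<close> of the
  topics chosen so far, every candidate is evaluated in one pass over the document.
\<close>

section \<open>The greedy bound\<close>

text \<open>Including \<epsilon> keeps the maximum defined for empty \<open>T\<close> and, for
  positive \<epsilon> and finite \<open>T\<close>, positive, so that \<open>ln\<close> can replace
  \<open>log_weight\<close>.\<close>

definition word_weight :: "real \<Rightarrow> ('t \<Rightarrow> 'w pmf) \<Rightarrow> 'w list \<Rightarrow> 't set \<Rightarrow> nat \<Rightarrow> real" where
  "word_weight \<epsilon> \<phi> d T i = Max (insert \<epsilon> ((\<lambda>\<tau>. pmf (\<phi> \<tau>) (d ! i)) ` T))"

text \<open>Real-valued form of \<open>fdot\<close>, meaningful also at the empty set, where the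
  greedy construction starts.\<close>

definition gain :: "real \<Rightarrow> ('t \<Rightarrow> 'w pmf) \<Rightarrow> 'w list \<Rightarrow> 't set \<Rightarrow> real" where
  "gain \<epsilon> \<phi> d T = (\<Sum>i<length d. ln (word_weight \<epsilon> \<phi> d T i) - ln \<epsilon>)"

lemma word_weight_empty [simp]: "word_weight \<epsilon> \<phi> d {} i = \<epsilon>"
  by (simp add: word_weight_def)

lemma word_weight_insert:
  assumes "finite T"
  shows "word_weight \<epsilon> \<phi> d (insert \<tau> T) i = max (pmf (\<phi> \<tau>) (d ! i)) (word_weight \<epsilon> \<phi> d T i)"
  using assms by (simp add: word_weight_def insert_commute[of \<epsilon>])

lemma word_weight_ge: "finite T \<Longrightarrow> \<epsilon> \<le> word_weight \<epsilon> \<phi> d T i"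
  by (simp add: word_weight_def)

lemma gain_empty [simp]: "gain \<epsilon> \<phi> d {} = 0"
  by (simp add: gain_def)

text \<open>The subtracted term does not depend on \<open>T\<close>, so comparing gains amounts to
  comparing products, which needs no logarithm.\<close>

lemma gain_eq_ln_prod:
  assumes "0 < \<epsilon>" "finite T"
  shows "gain \<epsilon> \<phi> d T = ln (\<Prod>i<length d. word_weight \<epsilon> \<phi> d T i) - length d * ln \<epsilon>"
proof -
  have "0 < word_weight \<epsilon> \<phi> d T i" for i
    using word_weight_ge[OF assms(2), of \<epsilon> \<phi> d i] assms(1) by linarith
  then show ?thesis
    using ln_prod[of "{..<length d}" "word_weight \<epsilon> \<phi> d T"]
    by (simp add: gain_def sum_subtractf less_imp_neq[symmetric])
qed

text \<open>For \<open>y = 0\<close> the value -\<infinity> is absorbed because \<open>x\<close> is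
  positive; otherwise \<open>ln\<close> is monotone.\<close>

lemma log_weight_max:
  assumes "0 < x" "0 \<le> y"
  shows "max (log_weight x) (log_weight y) = ereal (ln (max x y))"
  using assms by (auto simp: log_weight_def max_def)

text \<open>Topics are added one at a time, the weight reached so far being the positive argument of
  \<open>log_weight_max\<close>. The induction starts at singletons because \<open>Max\<close> of
  the empty set is unspecified.\<close>

lemma max_log_weight_eq:
  assumes "0 < \<epsilon>" "finite T" "T \<noteq> {}"
  shows "max (log_weight \<epsilon>) (Max ((\<lambda>\<tau>. log_weight (pmf (\<phi> \<tau>) (d ! i))) ` T))
    = ereal (ln (word_weight \<epsilon> \<phi> d T i))"
  using assms(2,3)
proof (induction rule: finite_ne_induct)
  case (singleton \<tau>)
  show ?case
    using log_weight_max[OF assms(1), of "pmf (\<phi> \<tau>) (d ! i)"]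
    by (simp add: word_weight_insert max.commute[of _ \<epsilon>])
next
  case (insert \<tau> T)
  let ?l = "\<lambda>\<tau>. log_weight (pmf (\<phi> \<tau>) (d ! i))"
  have pos: "0 < word_weight \<epsilon> \<phi> d T i"
    using word_weight_ge[OF insert(1), of \<epsilon> \<phi> d i] assms(1) by linarith
  have "max (log_weight \<epsilon>) (Max (?l ` insert \<tau> T))
      = max (max (log_weight \<epsilon>) (Max (?l ` T))) (?l \<tau>)"
    using insert(1,2) by (simp add: max.commute max.left_commute)
  also have "\<dots> = max (log_weight (word_weight \<epsilon> \<phi> d T i)) (?l \<tau>)"
    using pos insert by (simp add: log_weight_def)
  also have "\<dots> = ereal (ln (word_weight \<epsilon> \<phi> d (insert \<tau> T) i))"
    using log_weight_max[OF pos, of "pmf (\<phi> \<tau>) (d ! i)"] insert(1)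
    by (simp add: word_weight_insert max.commute)
  finally show ?case .
qed

lemma fdot_eq_gain:
  assumes "0 < \<epsilon>" "finite T" "T \<noteq> {}"
  shows "fdot \<epsilon> \<phi> d T = ereal (gain \<epsilon> \<phi> d T)"
proof -
  have eps: "log_weight \<epsilon> = ereal (ln \<epsilon>)" using assms(1) by (simp add: log_weight_def)
  show ?thesis unfolding fdot_def max_log_weight_eq[OF assms] by (simp add: eps gain_def)
qed

section \<open>Submodularity and the greedy recursion\<close>

text \<open>For each word, the weight under \<open>T\<close> is attained by \<epsilon> or by a
  single topic of \<open>T\<close>. Adding that topic alone to \<open>S\<close> already reaches this
  weight, and all other summands are nonnegative.\<close>

lemma gain_submodular:
  assumes "0 < \<epsilon>" "finite T" "finite S"
  shows "gain \<epsilon> \<phi> d T - gain \<epsilon> \<phi> d S \<le> (\<Sum>\<tau>\<in>T. gain \<epsilon> \<phi> d (insert \<tau> S) - gain \<epsilon> \<phi> d S)"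
proof -
  let ?w = "word_weight \<epsilon> \<phi> d"
  have pos: "0 < ?w S i" for i
    using word_weight_ge[OF assms(3), of \<epsilon> \<phi> d i] assms(1) by linarith
  have grow: "ln (?w S i) \<le> ln (?w (insert \<tau> S) i)" for \<tau> i
    using pos[of i] by (simp add: word_weight_insert[OF assms(3)])
  have "ln (?w T i) - ln (?w S i) \<le> (\<Sum>\<tau>\<in>T. ln (?w (insert \<tau> S) i) - ln (?w S i))" for i
  proof -
    have "?w T i \<in> insert \<epsilon> ((\<lambda>\<tau>. pmf (\<phi> \<tau>) (d ! i)) ` T)"
      unfolding word_weight_def using assms(2) by (intro Max_in) auto
    then consider "?w T i = \<epsilon>" | \<tau> where "\<tau> \<in> T" "?w T i = pmf (\<phi> \<tau>) (d ! i)" by auto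
    then show ?thesis
    proof cases
      case 1
      then have "ln (?w T i) \<le> ln (?w S i)"
        using word_weight_ge[OF assms(3), of \<epsilon> \<phi> d i] assms(1) by simp
      moreover have "0 \<le> (\<Sum>\<tau>\<in>T. ln (?w (insert \<tau> S) i) - ln (?w S i))"
        using grow by (intro sum_nonneg) simp
      ultimately show ?thesis by linarith
    next
      case (2 \<tau>)
      have "0 < ?w T i"
        using word_weight_ge[OF assms(2), of \<epsilon> \<phi> d i] assms(1) by linarith
      then have "ln (?w T i) \<le> ln (?w (insert \<tau> S) i)"
        using 2 by (simp add: word_weight_insert[OF assms(3)])
      also have "\<dots> - ln (?w S i) \<le> (\<Sum>\<tau>\<in>T. ln (?w (insert \<tau> S) i) - ln (?w S i))"
        using 2 grow assms(2)
        by (intro member_le_sum[where f = "\<lambda>\<tau>. ln (?w (insert \<tau> S) i) - ln (?w S i)"]) auto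
      finally show ?thesis by simp
    qed
  qed
  then have "(\<Sum>i<length d. ln (?w T i) - ln (?w S i))
      \<le> (\<Sum>i<length d. \<Sum>\<tau>\<in>T. ln (?w (insert \<tau> S) i) - ln (?w S i))"
    by (intro sum_mono)
  also have "\<dots> = (\<Sum>\<tau>\<in>T. \<Sum>i<length d. ln (?w (insert \<tau> S) i) - ln (?w S i))"
    by (rule sum.swap)
  finally show ?thesis
    by (simp add: gain_def flip: sum_subtractf)
qed

text \<open>The marginal gains of the topics of \<open>T\<close> sum to at least the gap between
  \<open>T\<close> and \<open>S\<close>, there are at most \<kappa> of them, and none exceeds that
  of \<sigma>. So at most the fraction 1 - 1/\<kappa> of the gap remains.\<close>

lemma gain_greedy_step:
  assumes "0 < \<epsilon>" "finite T" "finite S" "card T \<le> \<kappa>" "1 \<le> \<kappa>"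
    and best: "\<And>\<tau>. \<tau> \<in> T \<Longrightarrow> gain \<epsilon> \<phi> d (insert \<tau> S) \<le> gain \<epsilon> \<phi> d (insert \<sigma> S)"
    and bound: "(1 - (1 - 1 / \<kappa>) ^ k) * gain \<epsilon> \<phi> d T \<le> gain \<epsilon> \<phi> d S"
  shows "(1 - (1 - 1 / \<kappa>) ^ Suc k) * gain \<epsilon> \<phi> d T \<le> gain \<epsilon> \<phi> d (insert \<sigma> S)"
proof -
  let ?g = "gain \<epsilon> \<phi> d"
  \<comment> \<open>Monotonicity makes the marginal gain of \<sigma> nonnegative, so that
    \<open>card T\<close> can be replaced by the possibly larger \<kappa> below.\<close>
  have "?g S \<le> ?g (insert \<sigma> S)"
    unfolding gain_def
  proof (rule sum_mono)
    fix i
    have "0 < word_weight \<epsilon> \<phi> d S i"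
      using word_weight_ge[OF assms(3), of \<epsilon> \<phi> d i] assms(1) by linarith
    then show "ln (word_weight \<epsilon> \<phi> d S i) - ln \<epsilon> \<le> ln (word_weight \<epsilon> \<phi> d (insert \<sigma> S) i) - ln \<epsilon>"
      by (simp add: word_weight_insert[OF assms(3)])
  qed
  have "?g T - ?g S \<le> (\<Sum>\<tau>\<in>T. ?g (insert \<tau> S) - ?g S)"
    by (rule gain_submodular[OF assms(1-3)])
  also have "\<dots> \<le> card T * (?g (insert \<sigma> S) - ?g S)"
    using best by (intro sum_bounded_above) auto
  also have "\<dots> \<le> \<kappa> * (?g (insert \<sigma> S) - ?g S)"
    using \<open>?g S \<le> ?g (insert \<sigma> S)\<close> assms(4) by (intro mult_right_mono) auto
  finally have "(?g T - ?g S) / \<kappa> \<le> ?g (insert \<sigma> S) - ?g S"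
    using assms(5) by (simp add: field_simps)
  \<comment> \<open>Rearranged, \<open>bound\<close> says that the gap is at most
    \<open>(1 - 1 / \<kappa>) ^ k * ?g T\<close>.\<close>
  moreover have "(1 - 1 / \<kappa>) * (?g T - ?g S) \<le> (1 - 1 / \<kappa>) * ((1 - 1 / \<kappa>) ^ k * ?g T)"
    using bound assms(5) by (intro mult_left_mono) (auto simp: algebra_simps)
  ultimately show ?thesis
    by (simp add: algebra_simps diff_divide_distrib)
qed

text \<open>This is \<open>1 + x \<le> exp x\<close> at \<open>x = - 1 / k\<close>, raised to the
  power \<open>k\<close>; the base is nonnegative since \<open>k\<close> is at least 1.\<close>

lemma one_minus_inverse_power_le:
  assumes "1 \<le> (k::nat)"
  shows "(1 - 1 / k) ^ k \<le> 1 / exp (1::real)"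
proof -
  have "(1 - 1 / k) ^ k \<le> exp (- 1 / k) ^ k"
    using exp_ge_add_one_self[of "- 1 / k"] assms by (intro power_mono) auto
  also have "\<dots> = exp (-1)"
    using assms by (simp flip: exp_of_nat_mult)
  finally show ?thesis
    by (simp add: exp_minus inverse_eq_divide)
qed


section \<open>Execution within a cost bound\<close>

text \<open>A total-correctness triple with a cost bound. By \<open>exec_deterministic\<close>, the
  execution that it asserts is the only one.\<close>

definition runs :: "com \<Rightarrow> store \<Rightarrow> nat \<Rightarrow> (store \<Rightarrow> bool) \<Rightarrow> bool" where
  "runs c s B Q \<longleftrightarrow> (\<exists>n t. exec c s n t \<and> n \<le> B \<and> Q t)"

lemma runs_mono:
  "runs c s B Q \<Longrightarrow> B \<le> B' \<Longrightarrow> (\<And>t. Q t \<Longrightarrow> Q' t) \<Longrightarrow> runs c s B' Q'"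
  unfolding runs_def by (meson le_trans)

lemma runs_Skip: "Q s \<Longrightarrow> runs Skip s 1 Q"
  unfolding runs_def by (blast intro: exec.Skip)

lemma runs_NWrite:
  "Q (nwrite a (nval i s) (nval e s) s) \<Longrightarrow> runs (NWrite a i e) s (ncost i + ncost e + 1) Q"
  unfolding runs_def by (blast intro: exec.NWrite)

lemma runs_RWrite:
  "Q (rwrite a (nval i s) (rval e s) s) \<Longrightarrow> runs (RWrite a i e) s (ncost i + rcost e + 1) Q"
  unfolding runs_def by (blast intro: exec.RWrite)

text \<open>The postcondition of the first command is the claim about the second, so no intermediate
  assertion has to be named.\<close>

lemma runs_Seq:
  assumes "runs c s B (\<lambda>t. runs c' t B' Q)"
  shows "runs (Seq c c') s (B + B') Q"
proof -
  from assms obtain m t n u where "exec c s m t" "m \<le> B" "exec c' t n u" "n \<le> B'" "Q u"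
    unfolding runs_def by blast
  then show ?thesis
    unfolding runs_def by (intro exI[of _ "m + n"] exI[of _ u]) (auto intro: exec.Seq)
qed

text \<open>The bound adds both branches instead of taking their maximum; this loses only constants
  and avoids case distinctions.\<close>

lemma runs_Cond:
  assumes "bval b s \<Longrightarrow> runs c s B Q" "\<not> bval b s \<Longrightarrow> runs c' s B' Q"
  shows "runs (Cond b c c') s (bcost b + (B + B')) Q"
proof (cases "bval b s")
  case True
  with assms(1) obtain n t where "exec c s n t" "n \<le> B" "Q t"
    unfolding runs_def by blast
  with True show ?thesis
    unfolding runs_def by (intro exI[of _ "bcost b + n"] exI[of _ t]) (auto intro: exec.CondTrue)
next
  case False
  with assms(2) obtain n t where "exec c' s n t" "n \<le> B'" "Q t"
    unfolding runs_def by blast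
  with False show ?thesis
    unfolding runs_def by (intro exI[of _ "bcost b + n"] exI[of _ t]) (auto intro: exec.CondFalse)
qed

text \<open>The invariant is indexed by the number of completed rounds; the extra
  \<open>bcost b\<close> pays for the final failing test.\<close>

lemma runs_While:
  assumes "I 0 s"
    and body: "\<And>k s. k < N \<Longrightarrow> I k s \<Longrightarrow> bval b s \<and> runs c s B (I (Suc k))"
    and exit: "\<And>s. I N s \<Longrightarrow> \<not> bval b s"
  shows "runs (While b c) s (N * (bcost b + B) + bcost b) (I N)"
proof -
  have "runs (While b c) s (m * (bcost b + B) + bcost b) (I N)" if "I k s" "k + m = N" for m k s
    using that
  proof (induction m arbitrary: k s)
    case 0
    then have "exec (While b c) s (bcost b) s" "I N s"
      using exit by (auto intro: exec.WhileFalse)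
    then show ?case unfolding runs_def by auto
  next
    case (Suc m)
    then have "bval b s" "runs c s B (I (Suc k))" using body[of k s] by auto
    then obtain n t where 1: "exec c s n t" "n \<le> B" "I (Suc k) t"
      unfolding runs_def by blast
    with Suc obtain n' u where "exec (While b c) t n' u" "n' \<le> m * (bcost b + B) + bcost b" "I N u"
      unfolding runs_def by fastforce
    with 1 \<open>bval b s\<close> show ?case
      unfolding runs_def
      by (intro exI[of _ "bcost b + n + n'"] exI[of _ u]) (auto intro: exec.WhileTrue)
  qed
  from this[of 0 s N] assms(1) show ?thesis by simp
qed

lemma iterations_invariant:
  assumes "I 0 s" "\<And>k s. I k s \<Longrightarrow> runs c s B (I (Suc k))"
  shows "\<exists>t. iterations c B K s t \<and> I K t"
proof -
  have "\<exists>t. iterations c B m s t \<and> I (k + m) t" if "I k s" for m k s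
    using that
  proof (induction m arbitrary: k s)
    case 0
    then show ?case by (auto intro: iterations.Done)
  next
    case (Suc m)
    from assms(2)[OF Suc.prems] obtain n t where "exec c s n t" "n \<le> B" "I (Suc k) t"
      unfolding runs_def by blast
    with Suc.IH[of "Suc k" t] show ?case by (auto intro: iterations.Step)
  qed
  from this[of 0 s K] assms(1) show ?thesis by simp
qed


section \<open>One greedy iteration as a program\<close>

text \<open>
  Scratch arrays, of which only cell 0 is used: natural arrays 3, 4 and 5 hold the candidate topic,
  the position in the document and the best topic; real arrays 2, 3 and 4 hold the best score, the
  score of the candidate and a single factor of it. Real array 1 holds for each document position
  the largest probability of its word under the chosen topics; it is initially 0, and \<open>\<epsilon>\<close> only
  enters when a score is computed.
\<close>

definition entry_exp :: rexp where
  "entry_exp = RRead 0 (NAdd (NMul (NRead 3 (NLit 0)) (NRead 0 (NLit 1))) (NRead 1 (NRead 4 (NLit 0))))"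

definition raise :: "nat \<Rightarrow> nexp \<Rightarrow> rexp \<Rightarrow> com" where
  "raise a i e = Cond (RLess (RRead a i) e) (RWrite a i e) Skip"

definition for_words :: "com \<Rightarrow> com" where
  "for_words c = Seq (NWrite 4 (NLit 0) (NLit 0))
     (While (NLess (NRead 4 (NLit 0)) (NRead 0 (NLit 0)))
        (Seq c (NWrite 4 (NLit 0) (NAdd (NRead 4 (NLit 0)) (NLit 1)))))"

definition score_com :: "real \<Rightarrow> com" where
  "score_com \<epsilon> = Seq (RWrite 3 (NLit 0) (RLit 1))
     (for_words
       (Seq (RWrite 4 (NLit 0) (RLit \<epsilon>))
       (Seq (raise 4 (NLit 0) (RRead 1 (NRead 4 (NLit 0))))
       (Seq (raise 4 (NLit 0) entry_exp)
         (RWrite 3 (NLit 0) (RMul (RRead 3 (NLit 0)) (RRead 4 (NLit 0))))))))"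

text \<open>The initial best score 0 lies below every score when \<epsilon> is positive, so
  candidate 0 is always recorded first. The strict comparison keeps the earliest maximizer.\<close>

definition select_com :: "real \<Rightarrow> com" where
  "select_com \<epsilon> =
     Seq (NWrite 3 (NLit 0) (NLit 0))
    (Seq (RWrite 2 (NLit 0) (RLit 0))
     (While (NLess (NRead 3 (NLit 0)) (NRead 0 (NLit 2)))
       (Seq (score_com \<epsilon>)
       (Seq (Cond (RLess (RRead 2 (NLit 0)) (RRead 3 (NLit 0)))
               (Seq (RWrite 2 (NLit 0) (RRead 3 (NLit 0)))
                    (NWrite 5 (NLit 0) (NRead 3 (NLit 0))))
               Skip)
         (NWrite 3 (NLit 0) (NAdd (NRead 3 (NLit 0)) (NLit 1)))))))"

text \<open>The winner is copied into the candidate cell so that \<open>entry_exp\<close> can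
  address it. The output counter is incremented before it serves as an index, because cell 0 holds
  the counter itself. Topics may be chosen repeatedly.\<close>

definition greedy_com :: "real \<Rightarrow> com" where
  "greedy_com \<epsilon> =
     Seq (select_com \<epsilon>)
    (Seq (NWrite 3 (NLit 0) (NRead 5 (NLit 0)))
    (Seq (for_words (raise 1 (NRead 4 (NLit 0)) entry_exp))
    (Seq (NWrite 2 (NLit 0) (NAdd (NRead 2 (NLit 0)) (NLit 1)))
         (NWrite 2 (NRead 2 (NLit 0)) (NRead 3 (NLit 0))))))"

section \<open>Meaning and cost of the program pieces\<close>

definition entry :: "store \<Rightarrow> nat \<Rightarrow> nat \<Rightarrow> real" where
  "entry s j i = rmem s 0 (j * nmem s 0 1 + nmem s 1 i)"

definition score :: "real \<Rightarrow> store \<Rightarrow> nat \<Rightarrow> real" where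
  "score \<epsilon> s j = (\<Prod>i<nmem s 0 0. max (entry s j i) (max (rmem s 1 i) \<epsilon>))"

text \<open>Frame condition: \<open>A\<close> and \<open>B\<close> list the natural and real arrays
  that may have been overwritten.\<close>

definition agree :: "nat set \<Rightarrow> nat set \<Rightarrow> store \<Rightarrow> store \<Rightarrow> bool" where
  "agree A B s t \<longleftrightarrow> (\<forall>a. a \<notin> A \<longrightarrow> nmem t a = nmem s a) \<and> (\<forall>b. b \<notin> B \<longrightarrow> rmem t b = rmem s b)"

lemma nmem_nwrite [simp]: "nmem (nwrite a i x s) = (nmem s)(a := (nmem s a)(i := x))"
  and rmem_nwrite [simp]: "rmem (nwrite a i x s) = rmem s"
  and nmem_rwrite [simp]: "nmem (rwrite a i y s) = nmem s"
  and rmem_rwrite [simp]: "rmem (rwrite a i y s) = (rmem s)(a := (rmem s a)(i := y))"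
  by (simp_all add: nwrite_def rwrite_def)

lemma rcost_entry_exp [simp]: "rcost entry_exp = 10"
  by (simp add: entry_exp_def)

lemma rval_entry_exp [simp]: "rval entry_exp s = entry s (nmem s 3 0) (nmem s 4 0)"
  by (simp add: entry_exp_def entry_def)

lemma runs_raise:
  assumes "Q (rwrite a (nval i s) (max (rmem s a (nval i s)) (rval e s)) s)"
  shows "runs (raise a i e) s (2 * ncost i + 2 * rcost e + 4) Q"
proof -
  have "runs (raise a i e) s
      (bcost (RLess (RRead a i) e) + ((ncost i + rcost e + 1) + 1)) Q"
    unfolding raise_def
  proof (rule runs_Cond)
    assume "bval (RLess (RRead a i) e) s"
    with assms show "runs (RWrite a i e) s (ncost i + rcost e + 1) Q"
      by (intro runs_RWrite) (simp add: max_def)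
  next
    assume "\<not> bval (RLess (RRead a i) e) s"
    \<comment> \<open>Rewriting the old value changes nothing, so one postcondition covers both
      branches.\<close>
    then have "rwrite a (nval i s) (max (rmem s a (nval i s)) (rval e s)) s = s"
      by (simp add: max_def rwrite_def)
    with assms show "runs Skip s 1 Q"
      by (intro runs_Skip) simp
  qed
  then show ?thesis by (rule runs_mono) auto
qed

text \<open>Per round, 11 is the test (5) plus the increment (6); the 8 is the initialization (3)
  plus the last test (5).\<close>

lemma runs_for_words:
  assumes "I 0 (nwrite 4 0 0 s)"
    and body: "\<And>i s. i < n \<Longrightarrow> I i s \<Longrightarrow> runs c s B (\<lambda>t. I (Suc i) (nwrite 4 0 (nmem t 4 0 + 1) t))"
    and inv: "\<And>i s. I i s \<Longrightarrow> nmem s 4 0 = i \<and> nmem s 0 0 = n"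
  shows "runs (for_words c) s (n * (B + 11) + 8) (I n)"
proof -
  let ?b = "NLess (NRead 4 (NLit 0)) (NRead 0 (NLit 0))"
  let ?c = "Seq c (NWrite 4 (NLit 0) (NAdd (NRead 4 (NLit 0)) (NLit 1)))"
  have "runs (While ?b ?c) (nwrite 4 0 0 s) (n * (bcost ?b + (B + 6)) + bcost ?b) (I n)"
  proof (rule runs_While)
    show "I 0 (nwrite 4 0 0 s)" by fact
    fix i s assume "i < n" "I i s"
    show "bval ?b s \<and> runs ?c s (B + 6) (I (Suc i))"
    proof
      show "bval ?b s" using inv[OF \<open>I i s\<close>] \<open>i < n\<close> by simp
      show "runs ?c s (B + 6) (I (Suc i))"
      proof (rule runs_Seq, rule runs_mono[OF body[OF \<open>i < n\<close> \<open>I i s\<close>] order_refl])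
        fix t assume "I (Suc i) (nwrite 4 0 (nmem t 4 0 + 1) t)"
        then have "runs (NWrite 4 (NLit 0) (NAdd (NRead 4 (NLit 0)) (NLit 1))) t
            (ncost (NLit 0) + ncost (NAdd (NRead 4 (NLit 0)) (NLit 1)) + 1) (I (Suc i))"
          by (intro runs_NWrite) simp
        then show "runs (NWrite 4 (NLit 0) (NAdd (NRead 4 (NLit 0)) (NLit 1))) t 6 (I (Suc i))"
          by (rule runs_mono) auto
      qed
    qed
  next
    fix s assume "I n s"
    from inv[OF this] show "\<not> bval ?b s" by simp
  qed
  then have "runs (for_words c) s
      ((ncost (NLit 0) + ncost (NLit 0) + 1) + (n * (bcost ?b + (B + 6)) + bcost ?b)) (I n)"
    unfolding for_words_def by (intro runs_Seq runs_NWrite) simp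
  then show ?thesis by (rule runs_mono) auto
qed

lemma runs_score_com:
  "runs (score_com \<epsilon>) s (nmem s 0 0 * 66 + 11)
     (\<lambda>t. rmem t 3 0 = score \<epsilon> s (nmem s 3 0) \<and> agree {4} {3, 4} s t)"
proof -
  define I where "I i t \<longleftrightarrow>
    nmem t 4 0 = i \<and>
    rmem t 3 0 = (\<Prod>h<i. max (entry s (nmem s 3 0) h) (max (rmem s 1 h) \<epsilon>)) \<and>
    agree {4} {3, 4} s t" for i t
  have "runs (score_com \<epsilon>) s
      ((ncost (NLit 0) + rcost (RLit 1) + 1) + (nmem s 0 0 * (55 + 11) + 8)) (I (nmem s 0 0))"
    unfolding score_com_def
  proof (intro runs_Seq runs_RWrite runs_for_words)
    show "I 0 (nwrite 4 0 0 (rwrite 3 (nval (NLit 0) s) (rval (RLit 1) s) s))"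
      by (simp add: I_def agree_def)
  next
    fix i t assume t: "I i t"
    then show "nmem t 4 0 = i \<and> nmem t 0 0 = nmem s 0 0"
      by (simp add: I_def agree_def)
    let ?c = "Seq (RWrite 4 (NLit 0) (RLit \<epsilon>))
       (Seq (raise 4 (NLit 0) (RRead 1 (NRead 4 (NLit 0))))
       (Seq (raise 4 (NLit 0) entry_exp)
         (RWrite 3 (NLit 0) (RMul (RRead 3 (NLit 0)) (RRead 4 (NLit 0))))))"
    \<comment> \<open>These costs add up to 48, rounded up to 55 below.\<close>
    have "runs ?c t
       ((ncost (NLit 0) + rcost (RLit \<epsilon>) + 1)
        + ((2 * ncost (NLit 0) + 2 * rcost (RRead 1 (NRead 4 (NLit 0))) + 4)
        + ((2 * ncost (NLit 0) + 2 * rcost entry_exp + 4)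
        + (ncost (NLit 0) + rcost (RMul (RRead 3 (NLit 0)) (RRead 4 (NLit 0))) + 1))))
       (\<lambda>t. I (Suc i) (nwrite 4 0 (nmem t 4 0 + 1) t))"
      using t
      by (intro runs_Seq runs_RWrite runs_raise)
        (auto simp: I_def agree_def entry_def max.commute max.left_commute)
    then show "runs ?c t 55 (\<lambda>t. I (Suc i) (nwrite 4 0 (nmem t 4 0 + 1) t))"
      by (rule runs_mono) auto
  qed
  then show ?thesis
    by (rule runs_mono) (auto simp: I_def score_def)
qed

lemma score_pos: "0 < \<epsilon> \<Longrightarrow> 0 < score \<epsilon> s j"
  unfolding score_def by (intro prod_pos) (auto simp: less_max_iff_disj)

lemma score_cong:
  assumes "nmem t 0 = nmem s 0" "nmem t 1 = nmem s 1" "rmem t 0 = rmem s 0" "rmem t 1 = rmem s 1"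
  shows "score \<epsilon> t = score \<epsilon> s"
  using assms by (simp add: score_def entry_def fun_eq_iff)

lemma runs_select_com:
  assumes "0 < \<epsilon>" "0 < nmem s 0 2"
  shows "runs (select_com \<epsilon>) s (nmem s 0 2 * (nmem s 0 0 * 66 + 41) + 20)
     (\<lambda>t. nmem t 5 0 < nmem s 0 2 \<and>
       (\<forall>j<nmem s 0 2. score \<epsilon> s j \<le> score \<epsilon> s (nmem t 5 0)) \<and> agree {3, 4, 5} {2, 3, 4} s t)"
proof -
  \<comment> \<open>The case \<open>k = 0\<close> is separate because array 5 is never reset: before
    the first candidate is scored it may be stale.\<close>
  define I where "I k t \<longleftrightarrow>
    nmem t 3 0 = k \<and>
    (if k = 0 then rmem t 2 0 = 0
     else nmem t 5 0 < k \<and> rmem t 2 0 = score \<epsilon> s (nmem t 5 0)) \<and>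
    (\<forall>j<k. score \<epsilon> s j \<le> rmem t 2 0) \<and>
    agree {3, 4, 5} {2, 3, 4} s t" for k t
  let ?b = "NLess (NRead 3 (NLit 0)) (NRead 0 (NLit 2))"
  let ?if = "Cond (RLess (RRead 2 (NLit 0)) (RRead 3 (NLit 0)))
               (Seq (RWrite 2 (NLit 0) (RRead 3 (NLit 0)))
                    (NWrite 5 (NLit 0) (NRead 3 (NLit 0))))
               Skip"
  let ?next = "NWrite 3 (NLit 0) (NAdd (NRead 3 (NLit 0)) (NLit 1))"
  let ?B = "(nmem s 0 0 * 66 + 11) + (16 + 6)"
  have "runs (select_com \<epsilon>) s
      ((ncost (NLit 0) + ncost (NLit 0) + 1) +
       ((ncost (NLit 0) + rcost (RLit 0) + 1) +
        (nmem s 0 2 * (bcost ?b + ?B) + bcost ?b))) (I (nmem s 0 2))"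
    unfolding select_com_def
  proof (intro runs_Seq runs_RWrite runs_NWrite runs_While)
    show "I 0 (rwrite 2 (nval (NLit 0) (nwrite 3 (nval (NLit 0) s) (nval (NLit 0) s) s))
       (rval (RLit 0) (nwrite 3 (nval (NLit 0) s) (nval (NLit 0) s) s))
       (nwrite 3 (nval (NLit 0) s) (nval (NLit 0) s) s))"
      by (simp add: I_def agree_def)
  next
    fix t assume "I (nmem s 0 2) t"
    then show "\<not> bval ?b t" by (simp add: I_def agree_def)
  next
    fix k t assume k: "k < nmem s 0 2" and t: "I k t"
    \<comment> \<open>Selection leaves the input and the stored weights alone, so scores may be
      taken in the initial store \<open>s\<close> throughout.\<close>
    have eqs: "nmem t 0 = nmem s 0" "nmem t 1 = nmem s 1" "rmem t 0 = rmem s 0" "rmem t 1 = rmem s 1"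
      "nmem t 3 0 = k"
      using t by (simp_all add: I_def agree_def)
    have "runs (Seq (score_com \<epsilon>) (Seq ?if ?next)) t ?B (I (Suc k))"
    proof (rule runs_Seq, rule runs_mono)
      show "runs (score_com \<epsilon>) t (nmem s 0 0 * 66 + 11)
          (\<lambda>u. rmem u 3 0 = score \<epsilon> s k \<and> agree {4} {3, 4} t u)"
        using runs_score_com[of \<epsilon> t] score_cong[OF eqs(1-4), of \<epsilon>] eqs by simp
      fix u assume u: "rmem u 3 0 = score \<epsilon> s k \<and> agree {4} {3, 4} t u"
      have "runs (Seq ?if ?next) u
        ((bcost (RLess (RRead 2 (NLit 0)) (RRead 3 (NLit 0))) +
          (((ncost (NLit 0) + rcost (RRead 3 (NLit 0)) + 1) +
            (ncost (NLit 0) + ncost (NRead 3 (NLit 0)) + 1)) + 1)) +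
         (ncost (NLit 0) + ncost (NAdd (NRead 3 (NLit 0)) (NLit 1)) + 1)) (I (Suc k))"
        using u t score_pos[OF assms(1), of s k]
        by (intro runs_Seq runs_Cond runs_NWrite runs_RWrite runs_Skip)
          (auto simp: I_def agree_def less_Suc_eq not_less split: if_splits
            intro: order_trans[OF _ less_imp_le])
      then show "runs (Seq ?if ?next) u (16 + 6) (I (Suc k))"
        by (rule runs_mono) auto
    qed simp
    with k eqs show "bval ?b t \<and> runs (Seq (score_com \<epsilon>) (Seq ?if ?next)) t ?B (I (Suc k))"
      by simp
  qed
  then show ?thesis
    by (rule runs_mono) (use assms in \<open>auto simp: I_def algebra_simps\<close>)
qed

text \<open>Specification of one iteration without scratch cells. Real array 1 is prescribed only at
  document positions, the only ones that scores read.\<close>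

definition greedy_step :: "real \<Rightarrow> store \<Rightarrow> nat \<Rightarrow> store \<Rightarrow> bool" where
  "greedy_step \<epsilon> s j t \<longleftrightarrow>
     j < nmem s 0 2 \<and> (\<forall>j'<nmem s 0 2. score \<epsilon> s j' \<le> score \<epsilon> s j) \<and>
     nmem t 0 = nmem s 0 \<and> nmem t 1 = nmem s 1 \<and> rmem t 0 = rmem s 0 \<and>
     (\<forall>i<nmem s 0 0. rmem t 1 i = max (rmem s 1 i) (entry s j i)) \<and>
     nmem t 2 = (nmem s 2)(0 := Suc (nmem s 2 0), Suc (nmem s 2 0) := j)"

lemma runs_greedy_com:
  assumes "0 < \<epsilon>" "0 < nmem s 0 2"
  shows "runs (greedy_com \<epsilon>) s
    (nmem s 0 2 * (nmem s 0 0 * 66 + 41) + nmem s 0 0 * 41 + 45) (\<lambda>t. \<exists>j. greedy_step \<epsilon> s j t)"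
proof -
  let ?n = "nmem s 0 0"
  let ?upd = "for_words (raise 1 (NRead 4 (NLit 0)) entry_exp)"
  let ?out1 = "NWrite 2 (NLit 0) (NAdd (NRead 2 (NLit 0)) (NLit 1))"
  let ?out2 = "NWrite 2 (NRead 2 (NLit 0)) (NRead 3 (NLit 0))"
  have "runs (greedy_com \<epsilon>) s
     ((nmem s 0 2 * (?n * 66 + 41) + 20) + (4 + ((?n * (28 + 11) + 8) + (6 + 6))))
     (\<lambda>t. \<exists>j. greedy_step \<epsilon> s j t)"
    unfolding greedy_com_def
  proof (rule runs_Seq, rule runs_mono[OF runs_select_com[OF assms] order_refl])
    fix t assume t: "nmem t 5 0 < nmem s 0 2 \<and>
       (\<forall>j<nmem s 0 2. score \<epsilon> s j \<le> score \<epsilon> s (nmem t 5 0)) \<and> agree {3, 4, 5} {2, 3, 4} s t"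
    define j where "j = nmem t 5 0"
    \<comment> \<open>Positions from \<open>i\<close> on must still hold their old values, since
      each is raised only in its own round.\<close>
    define I where "I i u \<longleftrightarrow>
      nmem u 4 0 = i \<and> nmem u 3 0 = j \<and>
      (\<forall>h. rmem u 1 h = (if h < i then max (rmem s 1 h) (entry s j h) else rmem s 1 h)) \<and>
      nmem u 0 = nmem s 0 \<and> nmem u 1 = nmem s 1 \<and> nmem u 2 = nmem s 2 \<and> rmem u 0 = rmem s 0"
      for i and u :: store
    have "runs (Seq (NWrite 3 (NLit 0) (NRead 5 (NLit 0))) (Seq ?upd (Seq ?out1 ?out2))) t
       ((ncost (NLit 0) + ncost (NRead 5 (NLit 0)) + 1) + ((?n * (28 + 11) + 8) + (6 + 6)))
       (\<lambda>t. \<exists>j. greedy_step \<epsilon> s j t)"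
    proof (intro runs_Seq[where B' = "_ + _"] runs_NWrite, rule runs_mono)
      let ?t = "nwrite 3 (nval (NLit 0) t) (nval (NRead 5 (NLit 0)) t) t"
      show "runs ?upd ?t (?n * (28 + 11) + 8) (I ?n)"
      proof (rule runs_for_words)
        show "I 0 (nwrite 4 0 0 ?t)"
          using t by (simp add: I_def agree_def j_def)
      next
        fix i u assume u: "I i u"
        then show "nmem u 4 0 = i \<and> nmem u 0 0 = ?n" by (simp add: I_def)
        have "runs (raise 1 (NRead 4 (NLit 0)) entry_exp) u
           (2 * ncost (NRead 4 (NLit 0)) + 2 * rcost entry_exp + 4)
           (\<lambda>t. I (Suc i) (nwrite 4 0 (nmem t 4 0 + 1) t))"
          using u by (intro runs_raise) (auto simp: I_def entry_def less_Suc_eq)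
        then show "runs (raise 1 (NRead 4 (NLit 0)) entry_exp) u 28
           (\<lambda>t. I (Suc i) (nwrite 4 0 (nmem t 4 0 + 1) t))"
          by (rule runs_mono) auto
      qed
      fix u assume u: "I ?n u"
      have "runs (Seq ?out1 ?out2) u
         ((ncost (NLit 0) + ncost (NAdd (NRead 2 (NLit 0)) (NLit 1)) + 1) +
          (ncost (NRead 2 (NLit 0)) + ncost (NRead 3 (NLit 0)) + 1))
         (greedy_step \<epsilon> s j)"
        using u t
        by (intro runs_Seq runs_NWrite) (auto simp: I_def greedy_step_def j_def fun_eq_iff)
      then show "runs (Seq ?out1 ?out2) u (6 + 6) (\<lambda>t. \<exists>j. greedy_step \<epsilon> s j t)"
        by (rule runs_mono) auto
    qed simp
    then show "runs (Seq (NWrite 3 (NLit 0) (NRead 5 (NLit 0))) (Seq ?upd (Seq ?out1 ?out2))) t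
       (4 + ((?n * (28 + 11) + 8) + (6 + 6))) (\<lambda>t. \<exists>j. greedy_step \<epsilon> s j t)"
      by (rule runs_mono) auto
  qed
  then show ?thesis by (rule runs_mono) (auto simp: algebra_simps)
qed


section \<open>The input and the invariant of the iterations\<close>

lemma position_nth:
  assumes "x \<in> set xs"
  shows "position xs x < length xs \<and> xs ! position xs x = x"
  unfolding position_def using assms by - (rule LeastI_ex, auto simp: in_set_conv_nth)

text \<open>Row-major addressing: dropping the first row shifts the address by the common row length
  \<open>m\<close>.\<close>

lemma nth_concat_uniform:
  assumes "\<And>xs. xs \<in> set xss \<Longrightarrow> length xs = m" "j < length xss" "p < m"
  shows "j * m + p < length (concat xss) \<and> concat xss ! (j * m + p) = xss ! j ! p"
  using assms
proof (induction xss arbitrary: j)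
  case Nil
  then show ?case by simp
next
  case (Cons xs xss)
  then show ?case
    by (cases j) (auto simp: nth_append add.assoc)
qed

lemma entry_input_store:
  assumes "j < length ts" "i < length d" "set d \<subseteq> set vs"
  shows "entry (input_store vs ts \<phi> d \<kappa>) j i = pmf (\<phi> (ts ! j)) (d ! i)"
proof -
  have p: "position vs (d ! i) < length vs \<and> vs ! position vs (d ! i) = d ! i"
    using assms(2,3) by (intro position_nth) (auto dest: nth_mem)
  let ?xss = "map (\<lambda>\<tau>. map (pmf (\<phi> \<tau>)) vs) ts"
  have "j * length vs + position vs (d ! i) < length (concat ?xss) \<and>
      concat ?xss ! (j * length vs + position vs (d ! i)) = ?xss ! j ! position vs (d ! i)"
    by (rule nth_concat_uniform) (use p assms in auto)
  with p assms show ?thesis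
    by (simp add: entry_def input_store_def cells_def)
qed

definition chosen :: "'t list \<Rightarrow> store \<Rightarrow> 't set" where
  "chosen ts s = (\<lambda>j. ts ! j) ` output_positions s"

lemma finite_chosen: "finite (chosen ts s)"
  by (simp add: chosen_def output_positions_def)

text \<open>The bound is kept for all competitors \<open>T\<close> at once, so no optimum has to be
  fixed in advance. Array 1 starts at 0, hence the maximum with \<epsilon> in the weight
  condition.\<close>

definition greedy_inv ::
  "real \<Rightarrow> 'w list \<Rightarrow> 't list \<Rightarrow> ('t \<Rightarrow> 'w pmf) \<Rightarrow> 'w list \<Rightarrow> nat \<Rightarrow> nat \<Rightarrow> store \<Rightarrow> bool" where
  "greedy_inv \<epsilon> vs ts \<phi> d \<kappa> k s \<longleftrightarrow>
     nmem s 0 = nmem (input_store vs ts \<phi> d \<kappa>) 0 \<and>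
     nmem s 1 = nmem (input_store vs ts \<phi> d \<kappa>) 1 \<and>
     rmem s 0 = rmem (input_store vs ts \<phi> d \<kappa>) 0 \<and>
     nmem s 2 0 = k \<and> output_positions s \<subseteq> {..<length ts} \<and>
     (\<forall>i<length d. max (rmem s 1 i) \<epsilon> = word_weight \<epsilon> \<phi> d (chosen ts s) i) \<and>
     (\<forall>T\<subseteq>set ts. card T \<le> \<kappa> \<longrightarrow>
       (1 - (1 - 1 / \<kappa>) ^ k) * gain \<epsilon> \<phi> d T \<le> gain \<epsilon> \<phi> d (chosen ts s))"

lemma input_store_sizes:
  "nmem (input_store vs ts \<phi> d \<kappa>) 0 0 = length d"
  "nmem (input_store vs ts \<phi> d \<kappa>) 0 2 = length ts"
  by (simp_all add: input_store_def cells_def)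

lemma greedy_inv_init: "greedy_inv \<epsilon> vs ts \<phi> d \<kappa> 0 (input_store vs ts \<phi> d \<kappa>)" if "0 < \<epsilon>"
  using that by (simp add: greedy_inv_def chosen_def output_positions_def input_store_def)

text \<open>Scores are products of the weights after adding a candidate, so the topic of maximal
  score has maximal gain and \<open>gain_greedy_step\<close> applies.\<close>

lemma greedy_inv_step:
  assumes "0 < \<epsilon>" "1 \<le> \<kappa>" "set d \<subseteq> set vs"
    and inv: "greedy_inv \<epsilon> vs ts \<phi> d \<kappa> k s" and step: "greedy_step \<epsilon> s j t"
  shows "greedy_inv \<epsilon> vs ts \<phi> d \<kappa> (Suc k) t"
proof -
  let ?S = "chosen ts s"
  note inv' = inv[unfolded greedy_inv_def]
  note step' = step[unfolded greedy_step_def]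
  have sizes: "nmem s 0 0 = length d" "nmem s 0 2 = length ts"
    using inv' by (simp_all add: input_store_sizes)
  have entry: "entry s j' i = pmf (\<phi> (ts ! j')) (d ! i)" if "j' < length ts" "i < length d" for j' i
    using entry_input_store[OF that assms(3), of \<phi> \<kappa>] inv' by (simp add: entry_def)
  have j: "j < length ts" using step' sizes by simp
  \<comment> \<open>The new entry goes just behind the old ones, which stay untouched.\<close>
  have "output_positions t = insert j (output_positions s)"
    using step' by (auto simp: output_positions_def lessThan_Suc)
  then have out: "output_positions t \<subseteq> {..<length ts}" "chosen ts t = insert (ts ! j) ?S"
    using inv' j by (auto simp: chosen_def)
  have weight: "max (rmem t 1 i) \<epsilon> = word_weight \<epsilon> \<phi> d (chosen ts t) i" if "i < length d" for i
  proof -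
    have "max (rmem t 1 i) \<epsilon> = max (entry s j i) (max (rmem s 1 i) \<epsilon>)"
      using step' sizes that by (simp add: max.commute max.left_commute)
    then show ?thesis
      using inv' that j by (simp add: out(2) word_weight_insert finite_chosen entry)
  qed
  have score: "score \<epsilon> s j' = (\<Prod>i<length d. word_weight \<epsilon> \<phi> d (insert (ts ! j') ?S) i)"
    if "j' < length ts" for j'
    unfolding score_def sizes
    by (rule prod.cong) (use inv' that in \<open>auto simp: word_weight_insert finite_chosen entry\<close>)
  \<comment> \<open>Passing from scores to gains, the same constant is subtracted on both
    sides.\<close>
  have best: "gain \<epsilon> \<phi> d (insert (ts ! j') ?S) \<le> gain \<epsilon> \<phi> d (insert (ts ! j) ?S)"
    if "j' < length ts" for j'
  proof -
    have "ln (score \<epsilon> s j') \<le> ln (score \<epsilon> s j)"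
      using step' sizes that score_pos[OF assms(1)] by simp
    then show ?thesis
      using assms(1) that j by (simp add: gain_eq_ln_prod finite_chosen score)
  qed
  have "(1 - (1 - 1 / \<kappa>) ^ Suc k) * gain \<epsilon> \<phi> d T \<le> gain \<epsilon> \<phi> d (chosen ts t)"
    if T: "T \<subseteq> set ts" "card T \<le> \<kappa>" for T
    unfolding out(2)
  proof (rule gain_greedy_step[OF assms(1) _ finite_chosen T(2) assms(2)])
    show "finite T" using T(1) finite_subset by blast
    show "(1 - (1 - 1 / \<kappa>) ^ k) * gain \<epsilon> \<phi> d T \<le> gain \<epsilon> \<phi> d ?S"
      using inv' T by blast
    fix \<tau> assume "\<tau> \<in> T"
    then obtain j' where "j' < length ts" "\<tau> = ts ! j'"
      using T(1) by (metis in_set_conv_nth subsetD)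
    then show "gain \<epsilon> \<phi> d (insert \<tau> ?S) \<le> gain \<epsilon> \<phi> d (insert (ts ! j) ?S)"
      using best by simp
  qed
  then show ?thesis
    using inv' step' out(1) weight unfolding greedy_inv_def by simp
qed

lemma iterations_greedy:
  assumes "0 < \<epsilon>" "1 \<le> \<kappa>" "set d \<subseteq> set vs" "length d \<le> L" "1 \<le> L" "1 \<le> length ts"
  shows "\<exists>s. iterations (greedy_com \<epsilon>) (200 * (L * length ts)) \<kappa> (input_store vs ts \<phi> d \<kappa>) s \<and>
    greedy_inv \<epsilon> vs ts \<phi> d \<kappa> \<kappa> s"
proof (rule iterations_invariant[where I = "greedy_inv \<epsilon> vs ts \<phi> d \<kappa>"])
  show "greedy_inv \<epsilon> vs ts \<phi> d \<kappa> 0 (input_store vs ts \<phi> d \<kappa>)"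
    by (rule greedy_inv_init[OF assms(1)])
  fix k s assume inv: "greedy_inv \<epsilon> vs ts \<phi> d \<kappa> k s"
  then have sizes: "nmem s 0 0 = length d" "nmem s 0 2 = length ts"
    by (simp_all add: greedy_inv_def input_store_sizes)
  let ?N = "length ts"
  \<comment> \<open>Every term is bounded by a multiple of \<open>L * ?N\<close>, and 66 + 41 + 41 +
    45 = 193 is at most 200. \<open>1 \<le> L\<close> covers the empty document.\<close>
  have 1: "?N * length d \<le> L * ?N" using assms(4) by (simp add: mult.commute)
  have 2: "?N \<le> L * ?N" "L \<le> L * ?N" using assms(5,6) by simp_all
  show "runs (greedy_com \<epsilon>) s (200 * (L * ?N)) (greedy_inv \<epsilon> vs ts \<phi> d \<kappa> (Suc k))"
  proof (rule runs_mono)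
    show "runs (greedy_com \<epsilon>) s (?N * (length d * 66 + 41) + length d * 41 + 45)
        (\<lambda>t. \<exists>j. greedy_step \<epsilon> s j t)"
      using runs_greedy_com[OF assms(1), of s] assms(6) sizes by (simp add: Suc_le_eq)
    have "?N * (length d * 66 + 41) + length d * 41 + 45
        = 66 * (?N * length d) + 41 * ?N + 41 * length d + 45"
      by (simp add: algebra_simps)
    also have "\<dots> \<le> 200 * (L * ?N)" using 1 2 assms(4-6) by linarith
    finally show "?N * (length d * 66 + 41) + length d * 41 + 45 \<le> 200 * (L * ?N)" .
  qed (use greedy_inv_step[OF assms(1-3) inv] in blast)
qed

lemma chosen_approximates:
  assumes "0 < \<epsilon>" "1 \<le> \<kappa>" and inv: "greedy_inv \<epsilon> vs ts \<phi> d \<kappa> \<kappa> s"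
    and T: "T \<subseteq> set ts" "card T \<le> \<kappa>"
  shows "(1 - 1 / exp 1) * gain \<epsilon> \<phi> d T \<le> gain \<epsilon> \<phi> d (chosen ts s)"
proof -
  have "finite T" using T(1) finite_subset by blast
  \<comment> \<open>Nonnegativity is needed to lower the factor from
    \<open>1 - (1 - 1 / \<kappa>) ^ \<kappa>\<close> to \<open>1 - 1 / exp 1\<close>.\<close>
  then have "0 \<le> gain \<epsilon> \<phi> d T"
    using word_weight_ge[of T \<epsilon> \<phi> d] assms(1) unfolding gain_def
    by (intro sum_nonneg) (simp add: ln_mono)
  then have "(1 - 1 / exp 1) * gain \<epsilon> \<phi> d T \<le> (1 - (1 - 1 / \<kappa>) ^ \<kappa>) * gain \<epsilon> \<phi> d T"
    using one_minus_inverse_power_le[OF assms(2)] by (intro mult_right_mono) auto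
  also have "\<dots> \<le> gain \<epsilon> \<phi> d (chosen ts s)"
    using inv T unfolding greedy_inv_def by blast
  finally show ?thesis .
qed

theorem mainTheorem5:
  shows "\<exists>C::nat. \<forall>\<epsilon>::real. 0 < \<epsilon> \<longrightarrow> (\<exists>body::com.
    \<forall>(V::'w set) (\<Phi>::'t set) (\<phi>::'t \<Rightarrow> 'w pmf) (d::'w list) (\<kappa>::nat) (L::nat)
      (vs::'w list) (ts::'t list).
      finite V \<and> distinct vs \<and> set vs = V \<and>
      finite \<Phi> \<and> distinct ts \<and> set ts = \<Phi> \<and>
      (\<forall>\<tau>\<in>\<Phi>. set_pmf (\<phi> \<tau>) \<subseteq> V) \<and>
      (\<forall>\<tau>\<in>\<Phi>. \<forall>v\<in>V. pmf (\<phi> \<tau>) v \<noteq> 0 \<longrightarrow> \<epsilon> < pmf (\<phi> \<tau>) v) \<and>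
      set d \<subseteq> V \<and> length d \<le> L \<and> 1 \<le> L \<and>
      1 \<le> \<kappa> \<and> \<kappa> \<le> card \<Phi>
      \<longrightarrow> (\<exists>s E.
        iterations body (C * (L * card \<Phi>)) \<kappa> (input_store vs ts \<phi> d \<kappa>) s \<and>
        output_positions s \<subseteq> {..<length ts} \<and>
        E = (\<lambda>j. ts ! j) ` output_positions s \<and>
        E \<subseteq> \<Phi> \<and> 1 \<le> card E \<and> card E \<le> \<kappa> \<and>
        fdot \<epsilon> \<phi> d E \<ge>
          ereal (1 - 1 / exp 1) * Max {fdot \<epsilon> \<phi> d T | T. T \<subseteq> \<Phi> \<and> 1 \<le> card T \<and> card T \<le> \<kappa>}))"
\<comment> \<open>The constant is fixed before \<epsilon>, and the program depends on \<epsilon>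
  alone, so one program serves all inputs.\<close>
proof (intro exI[of _ 200] allI impI, rule exI[of _ "greedy_com _"], intro allI impI, elim conjE)
  fix \<epsilon> :: real and V :: "'w set" and \<Phi> :: "'t set" and \<phi> :: "'t \<Rightarrow> 'w pmf" and d :: "'w list"
    and \<kappa> L :: nat and vs :: "'w list" and ts :: "'t list"
  assume eps: "0 < \<epsilon>" and hyps: "set vs = V" "finite \<Phi>" "distinct ts" "set ts = \<Phi>"
    "set d \<subseteq> V" "length d \<le> L" "1 \<le> L" "1 \<le> \<kappa>" "\<kappa> \<le> card \<Phi>"
  have card: "card \<Phi> = length ts" using hyps distinct_card by blast
  obtain s where s: "iterations (greedy_com \<epsilon>) (200 * (L * card \<Phi>)) \<kappa> (input_store vs ts \<phi> d \<kappa>) s"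
    and inv: "greedy_inv \<epsilon> vs ts \<phi> d \<kappa> \<kappa> s"
    using iterations_greedy[OF eps, of \<kappa> d vs L ts \<phi>] hyps card by auto
  let ?E = "chosen ts s"
  let ?F = "{fdot \<epsilon> \<phi> d T | T. T \<subseteq> \<Phi> \<and> 1 \<le> card T \<and> card T \<le> \<kappa>}"
  have out: "output_positions s \<subseteq> {..<length ts}" "nmem s 2 0 = \<kappa>"
    using inv by (auto simp: greedy_inv_def)
  have E: "?E \<subseteq> \<Phi>"
    using out(1) hyps(4) by (auto simp: chosen_def)
  \<comment> \<open>At least one iteration has taken place; nonemptiness is what identifies
    \<open>fdot\<close> with \<open>gain\<close> at \<open>?E\<close>.\<close>
  have "?E \<noteq> {}"
    using out(2) hyps(8) by (auto simp: chosen_def output_positions_def lessThan_empty_iff)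
  then have E1: "1 \<le> card ?E"
    using finite_chosen[of ts s] by (simp add: Suc_le_eq card_gt_0_iff)
  \<comment> \<open>The \<kappa> output cells may repeat topics, so only an upper bound
    holds.\<close>
  have Ek: "card ?E \<le> \<kappa>"
    unfolding chosen_def output_positions_def out(2) image_image
    using card_image_le[of "{..<\<kappa>}"] by fastforce
  have "finite ?F"
    using hyps(2) by simp
  \<comment> \<open>The computed set is itself feasible, so the maximum is attained by some
    \<open>T\<close>.\<close>
  moreover have "?F \<noteq> {}" using E E1 Ek by blast
  ultimately have "Max ?F \<in> ?F" by (rule Max_in)
  then obtain T where T: "Max ?F = fdot \<epsilon> \<phi> d T" "T \<subseteq> \<Phi>" "1 \<le> card T" "card T \<le> \<kappa>"
    by auto
  then have fT: "Max ?F = ereal (gain \<epsilon> \<phi> d T)"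
    using fdot_eq_gain[OF eps, of T] by (metis card.empty card.infinite not_one_le_zero)
  have "ereal (1 - 1 / exp 1) * Max ?F \<le> fdot \<epsilon> \<phi> d ?E"
    unfolding fT fdot_eq_gain[OF eps finite_chosen \<open>?E \<noteq> {}\<close>]
    using chosen_approximates[OF eps hyps(8) inv, of T] T hyps(4) by simp
  with s out(1) E E1 Ek show "\<exists>s E.
        iterations (greedy_com \<epsilon>) (200 * (L * card \<Phi>)) \<kappa> (input_store vs ts \<phi> d \<kappa>) s \<and>
        output_positions s \<subseteq> {..<length ts} \<and>
        E = (\<lambda>j. ts ! j) ` output_positions s \<and>
        E \<subseteq> \<Phi> \<and> 1 \<le> card E \<and> card E \<le> \<kappa> \<and>
        fdot \<epsilon> \<phi> d E \<ge> ereal (1 - 1 / exp 1) * Max ?F"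
    by (auto simp: chosen_def)
qed

end
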